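(* Let $\widetilde X$ be an isothermic surface associated to the cylinder, $$\widetilde X=X-\frac{2}{M}\Big(f'X_{,1}+g'X_{,2}-gN\Big),\qquad M=2b+c(f-g),$$ with $b,c,f,g$ as described in the context, whose first fundamental form is given by $$I=\Big(\frac{c(f+g)}{M}\Big)^2(du_1^2+du_2^2).$$ Then the functions $$\omega=\frac{\epsilon\sqrt2\,(M+2cg)}{2M}\qquad\text{and}\qquad \Omega=\frac{\epsilon\sqrt2\,(f-g)}{f+g},$$ with $\epsilon=1$ if $c>0$ and $\epsilon=-1$ if $c<0$, are solutions of the Calapso equation.
   Context: The Calapso equation for a function $\omega(u_1,u_2)$ is $$\Big(\frac{\omega_{,u_1u_2}}{\omega}\Big)_{,u_1u_1}+\Big(\frac{\omega_{,u_1u_2}}{\omega}\Big)_{,u_2u_2}+\big(\omega^2\big)_{,u_1u_2}=0,$$ where subscripts after a comma denote partial derivatives. $X(u_1,u_2)=(\cos u_2,\sin u_2,u_1)$ is the cylinder, with inner unit normal $N=(-\cos u_2,-\sin u_2,0)$ and $X_{,i}=\partial X/\partial u_i$. Here $c\neq0$, $b\neq 0$ are real and $f=f(u_1)$, $g=g(u_2)$ are: (i) $c>0$: $f=\sqrt{A_1}\cosh(\sqrt c\,u_1)-\frac bc$, $g=\sqrt{B_1}\sin(\sqrt{1+c}\,u_2)+\frac b{1+c}$, $B_1>0$; (ii) $-1<c<0$: $f=\sqrt{A_1}\sin(\sqrt{-c}\,u_1)-\frac bc$, $g=\sqrt{B_1}\sin(\sqrt{1+c}\,u_2)+\frac b{1+c}$,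 $A_1>0$, $B_1>0$; (iii) $c<-1$: $f=\sqrt{A_1}\sin(\sqrt{-c}\,u_1)-\frac bc$, $g=\sqrt{B_1}\cosh(\sqrt{-1-c}\,u_2)+\frac b{1+c}$, $A_1>0$; where in (i)–(iii) $\frac{b^2}{c(1+c)}=cA_1-(1+c)B_1$; (iv) $c=-1$: $f=\sqrt{A_1}\sin u_1+b$, $g=\frac b2u_2^2+a_2u_2+b_2$, with $A_1+a_2^2+b_2^2-(b+b_2)^2=0$, $A_1>0$. The surface is considered where $f+g\neq0$ and $M\neq0$.
   Formalization: The printed Ω is not a solution (for c=-1, b=1, f=sin u_1+1, g=u_2^2/2 the Calapso left side is -8/9 at (0,1)); the formal statement uses Ω=ε√2(f-g)/(2(f+g)), and each function is claimed a solution where it is nonzero. *)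

theory Defs
  imports "HOL-Analysis.Analysis"
begin

section \<open>Partial derivatives\<close>

definition pd1 :: "(real \<times> real \<Rightarrow> 'a::real_normed_vector) \<Rightarrow> real \<times> real \<Rightarrow> 'a" where
  "pd1 F p = vector_derivative (\<lambda>s. F (s, snd p)) (at (fst p))"

definition pd2 :: "(real \<times> real \<Rightarrow> 'a::real_normed_vector) \<Rightarrow> real \<times> real \<Rightarrow> 'a" where
  "pd2 F p = vector_derivative (\<lambda>t. F (fst p, t)) (at (snd p))"

text \<open>Since \<open>vector_derivative\<close> is total, \<open>Ck_on k U F\<close> requires explicitly that
  the partial derivatives of \<open>F\<close> up to order \<open>k\<close> exist on the open set \<open>U\<close>, besides being
  continuous there.\<close>

primrec Ck_on :: "nat \<Rightarrow> (real \<times> real) set \<Rightarrow> (real \<times> real \<Rightarrow> 'a::real_normed_vector) \<Rightarrow> bool" where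
  "Ck_on 0 U F \<longleftrightarrow> continuous_on U F"
| "Ck_on (Suc k) U F \<longleftrightarrow>
     continuous_on U F \<and>
     (\<forall>p\<in>U. (\<lambda>s. F (s, snd p)) differentiable (at (fst p)) \<and>
             (\<lambda>t. F (fst p, t)) differentiable (at (snd p))) \<and>
     Ck_on k U (pd1 F) \<and> Ck_on k U (pd2 F)"

section \<open>The Calapso equation\<close>

text \<open>Classical solutions. The equation divides by \<open>w\<close> and contains fourth order derivatives of
  \<open>w\<close>, so \<open>w\<close> has to be zero-free and of class \<open>C\<^sup>4\<close> on \<open>U\<close>.\<close>

definition calapso_solution_on :: "(real \<times> real) set \<Rightarrow> (real \<times> real \<Rightarrow> real) \<Rightarrow> bool" where
  "calapso_solution_on U w \<longleftrightarrow>
     open U \<and> Ck_on 4 U w \<and> (\<forall>p\<in>U. w p \<noteq> 0) \<and>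
     (\<forall>p\<in>U. pd1 (pd1 (\<lambda>q. pd2 (pd1 w) q / w q)) p
            + pd2 (pd2 (\<lambda>q. pd2 (pd1 w) q / w q)) p
            + pd2 (pd1 (\<lambda>q. (w q)\<^sup>2)) p = 0)"

section \<open>Parametrized surfaces in Euclidean 3-space\<close>

type_synonym surface = "real \<times> real \<Rightarrow> real ^ 3"

definition ffE :: "surface \<Rightarrow> real \<times> real \<Rightarrow> real" where
  "ffE X p = pd1 X p \<bullet> pd1 X p"

definition ffF :: "surface \<Rightarrow> real \<times> real \<Rightarrow> real" where
  "ffF X p = pd1 X p \<bullet> pd2 X p"

definition ffG :: "surface \<Rightarrow> real \<times> real \<Rightarrow> real" where
  "ffG X p = pd2 X p \<bullet> pd2 X p"

definition unit_normal :: "surface \<Rightarrow> real \<times> real \<Rightarrow> real ^ 3" where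
  "unit_normal X p =
     (1 / norm (cross3 (pd1 X p) (pd2 X p))) *\<^sub>R cross3 (pd1 X p) (pd2 X p)"

text \<open>The mixed coefficient of the second fundamental form.\<close>

definition sffF :: "surface \<Rightarrow> real \<times> real \<Rightarrow> real" where
  "sffF X p = pd2 (pd1 X) p \<bullet> unit_normal X p"

text \<open>The coordinates are isothermal (conformal) and are lines of curvature: both fundamental
  forms are diagonal and the first one is a positive multiple of \<open>du1\<^sup>2 + du2\<^sup>2\<close>. In
  particular \<open>X\<close> is an immersion.\<close>

definition isothermic_on :: "(real \<times> real) set \<Rightarrow> surface \<Rightarrow> bool" where
  "isothermic_on U X \<longleftrightarrow>
     open U \<and> (\<forall>k. Ck_on k U X) \<and>
     (\<forall>p\<in>U. ffE X p = ffG X p \<and> 0 < ffE X p \<and> ffF X p = 0 \<and> sffF X p = 0)"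

section \<open>Isothermic surfaces associated to the cylinder\<close>

definition cylinder :: surface where
  "cylinder p = vector [cos (snd p), sin (snd p), fst p]"

definition cylinder_normal :: surface where
  "cylinder_normal p = vector [- cos (snd p), - sin (snd p), 0]"

inductive associated_data :: "real \<Rightarrow> real \<Rightarrow> (real \<Rightarrow> real) \<Rightarrow> (real \<Rightarrow> real) \<Rightarrow> bool"
  for b c :: real and f g :: "real \<Rightarrow> real" where
  pos: "\<lbrakk> c > 0; B1 > 0; b\<^sup>2 / (c * (1 + c)) = c * A1 - (1 + c) * B1;
     f = (\<lambda>u. sqrt A1 * cosh (sqrt c * u) - b / c);
     g = (\<lambda>u. sqrt B1 * sin (sqrt (1 + c) * u) + b / (1 + c)) \<rbrakk>
     \<Longrightarrow> associated_data b c f g"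
| between: "\<lbrakk> -1 < c; c < 0; A1 > 0; B1 > 0; b\<^sup>2 / (c * (1 + c)) = c * A1 - (1 + c) * B1;
     f = (\<lambda>u. sqrt A1 * sin (sqrt (- c) * u) - b / c);
     g = (\<lambda>u. sqrt B1 * sin (sqrt (1 + c) * u) + b / (1 + c)) \<rbrakk>
     \<Longrightarrow> associated_data b c f g"
| below: "\<lbrakk> c < -1; A1 > 0; b\<^sup>2 / (c * (1 + c)) = c * A1 - (1 + c) * B1;
     f = (\<lambda>u. sqrt A1 * sin (sqrt (- c) * u) - b / c);
     g = (\<lambda>u. sqrt B1 * cosh (sqrt (- 1 - c) * u) + b / (1 + c)) \<rbrakk>
     \<Longrightarrow> associated_data b c f g"
| minus_one: "\<lbrakk> c = -1; A1 > 0; A1 + a2\<^sup>2 + b2\<^sup>2 - (b + b2)\<^sup>2 = 0;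
     f = (\<lambda>u. sqrt A1 * sin u + b);
     g = (\<lambda>u. b / 2 * u\<^sup>2 + a2 * u + b2) \<rbrakk>
     \<Longrightarrow> associated_data b c f g"

definition assoc_M :: "real \<Rightarrow> real \<Rightarrow> (real \<Rightarrow> real) \<Rightarrow> (real \<Rightarrow> real) \<Rightarrow> real \<times> real \<Rightarrow> real" where
  "assoc_M b c f g p = 2 * b + c * (f (fst p) - g (snd p))"

definition assoc_domain :: "real \<Rightarrow> real \<Rightarrow> (real \<Rightarrow> real) \<Rightarrow> (real \<Rightarrow> real) \<Rightarrow> (real \<times> real) set" where
  "assoc_domain b c f g = {p. f (fst p) + g (snd p) \<noteq> 0 \<and> assoc_M b c f g p \<noteq> 0}"

definition assoc_surface :: "real \<Rightarrow> real \<Rightarrow> (real \<Rightarrow> real) \<Rightarrow> (real \<Rightarrow> real) \<Rightarrow> surface" where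
  "assoc_surface b c f g p =
     cylinder p - (2 / assoc_M b c f g p) *\<^sub>R
       (deriv f (fst p) *\<^sub>R pd1 cylinder p + deriv g (snd p) *\<^sub>R pd2 cylinder p
        - g (snd p) *\<^sub>R cylinder_normal p)"

definition eps :: "real \<Rightarrow> real" where
  "eps c = (if c > 0 then 1 else - 1)"

definition assoc_omega :: "real \<Rightarrow> real \<Rightarrow> (real \<Rightarrow> real) \<Rightarrow> (real \<Rightarrow> real) \<Rightarrow> real \<times> real \<Rightarrow> real" where
  "assoc_omega b c f g p =
     eps c * sqrt 2 * (assoc_M b c f g p + 2 * c * g (snd p)) / (2 * assoc_M b c f g p)"

text \<open>The factor 2 in the denominator is missing in the source. It is forced: the Calapso equation is
  not invariant under scaling, and twice this function is not a solution. (For \<open>c = -1\<close>,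
  \<open>b = 1\<close>, \<open>f u = sin u + 1\<close>, \<open>g u = u\<^sup>2 / 2\<close> the left-hand side of the equation for
  twice this function is \<open>-8/9\<close> at \<open>(0, 1)\<close>.) With it, this function is, up to sign,
  \<open>sqrt 2\<close> times the conformal factor times half the difference of the principal
  curvatures, just as \<open>assoc_omega\<close> is with half their sum.\<close>

definition assoc_Omega :: "real \<Rightarrow> (real \<Rightarrow> real) \<Rightarrow> (real \<Rightarrow> real) \<Rightarrow> real \<times> real \<Rightarrow> real" where
  "assoc_Omega c f g p =
     eps c * sqrt 2 * (f (fst p) - g (snd p)) / (2 * (f (fst p) + g (snd p)))"

end

theory Submission
  imports Defs
begin

text \<open>
  All four kinds of data obey the same equations. The function \<open>f\<close> solves \<open>f'' = c f + b\<close>, the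
  function \<open>g\<close> solves \<open>g'' = - (1 + c) g + b\<close>, and the algebraic constraint on the amplitudes says
  that the energies \<open>f'\<^sup>2 - c f\<^sup>2 - 2 b f\<close> and \<open>g'\<^sup>2 + (1 + c) g\<^sup>2 - 2 b g\<close> of these two oscillators are
  opposite (\<open>associated_data_profile_pair\<close>). Adding the two energies gives the single identity
  \<open>f'\<^sup>2 + g'\<^sup>2 + g\<^sup>2 = (f + g) M\<close> (\<open>first_integral\<close>), and everything else follows from it.

  Let \<open>E\<^sub>1\<close>, \<open>E\<^sub>2\<close> be the coordinate vectors of the cylinder and \<open>N\<close> its normal. The direction
  \<open>Y = f' E\<^sub>1 + g' E\<^sub>2 - g N\<close> has the derivatives \<open>(c f + b) E\<^sub>1\<close> and \<open>(b - c g) E\<^sub>2\<close>, and by the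
  identity \<open>|Y|\<^sup>2 = (f + g) M\<close>. Hence the tangent vectors of the associated surface are, up to the
  factors \<open>- c (f + g) / M\<close> and \<open>c (f + g) / M\<close>, the images of the orthonormal vectors \<open>E\<^sub>1\<close>, \<open>E\<^sub>2\<close>
  under the reflection along \<open>Y\<close>; this gives the metric. The mixed second derivative is a combination
  of the two tangent vectors, so that the parameter curves are lines of curvature.

  For \<open>\<Omega> = k (f - g) / (f + g)\<close> with \<open>k\<^sup>2 = 1 / 2\<close> one computes
  \<open>\<Omega>\<^sub>1\<^sub>2 / \<Omega> = 2 f' g' / (f + g)\<^sup>2\<close>, and each of the three terms of the Calapso equation is
  \<open>2 f' g' / (f + g)\<^sup>4\<close> times a polynomial in \<open>f, g, f', g'\<close>. These polynomials add up to zero by the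
  same identity (\<open>calapso_quotient\<close>).

  The function \<open>\<omega>\<close> needs no second computation: the substitution of \<open>- c b\<close>, \<open>c f + 2 b\<close>, \<open>- c g\<close> for
  \<open>b\<close>, \<open>f\<close>, \<open>g\<close> preserves the equations and the opposite energies (\<open>dual\<close>), turns \<open>f + g\<close> into \<open>M\<close>,
  and turns \<open>f - g\<close> into the numerator of \<open>\<omega>\<close>.
\<close>

section \<open>Calculus of partial derivatives\<close>

lemma pd1_eqI:
  assumes "((\<lambda>s. F (s, t)) has_vector_derivative d) (at s)"
  shows "pd1 F (s, t) = d"
  using assms by (simp add: pd1_def vector_derivative_at)

lemma pd2_eqI:
  assumes "((\<lambda>t. F (s, t)) has_vector_derivative d) (at t)"
  shows "pd2 F (s, t) = d"
  using assms by (simp add: pd2_def vector_derivative_at)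

text \<open>Repeated partial derivatives are computed by replacing an inner derivative by its value,
  which is known on an open set only. A partial derivative sees just one line through the point, so
  it matters that the slices of an open set are open.\<close>

lemma open_slice1: "open U \<Longrightarrow> open {x::real. (x, t::real) \<in> U}"
  using open_vimage [of U "\<lambda>x. (x, t)"]
  by (simp add: vimage_def continuous_on_Pair continuous_on_id continuous_on_const)

lemma open_slice2: "open U \<Longrightarrow> open {y::real. (s::real, y) \<in> U}"
  using open_vimage [of U "\<lambda>y. (s, y)"]
  by (simp add: vimage_def continuous_on_Pair continuous_on_id continuous_on_const)

lemma
  assumes "open U" "(s, t) \<in> U" and eq: "\<And>q. q \<in> U \<Longrightarrow> F q = G q"
  shows has_partial1_cong_on: "((\<lambda>s. F (s, t)) has_vector_derivative d) (at s) \<longleftrightarrow>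
      ((\<lambda>s. G (s, t)) has_vector_derivative d) (at s)"
    and has_partial2_cong_on: "((\<lambda>t. F (s, t)) has_vector_derivative d) (at t) \<longleftrightarrow>
      ((\<lambda>t. G (s, t)) has_vector_derivative d) (at t)"
proof -
  show "((\<lambda>s. F (s, t)) has_vector_derivative d) (at s) \<longleftrightarrow>
      ((\<lambda>s. G (s, t)) has_vector_derivative d) (at s)"
    by (rule iffI; erule has_vector_derivative_transform_within_open
        [OF _ open_slice1 [OF assms(1), of t]]) (auto simp: assms)
  show "((\<lambda>t. F (s, t)) has_vector_derivative d) (at t) \<longleftrightarrow>
      ((\<lambda>t. G (s, t)) has_vector_derivative d) (at t)"
    by (rule iffI; erule has_vector_derivative_transform_within_open
        [OF _ open_slice2 [OF assms(1), of s]]) (auto simp: assms)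
qed

lemma
  assumes "open U" "p \<in> U" and "\<And>q. q \<in> U \<Longrightarrow> F q = G q"
  shows pd1_cong_on: "pd1 F p = pd1 G p" and pd2_cong_on: "pd2 F p = pd2 G p"
proof -
  obtain s t where p: "p = (s, t)" by force
  note cong = has_partial1_cong_on [of U s t F G] has_partial2_cong_on [of U s t F G]
  show "pd1 F p = pd1 G p" "pd2 F p = pd2 G p"
    using assms cong by (simp_all add: p pd1_def pd2_def vector_derivative_def)
qed

section \<open>Closure properties of continuous differentiability\<close>

lemma Ck_on_imp_continuous: "Ck_on k U F \<Longrightarrow> continuous_on U F"
  by (cases k) auto

lemma Ck_on_SucD:
  assumes "Ck_on (Suc k) U F"
  shows "(s, t) \<in> U \<Longrightarrow> ((\<lambda>s. F (s, t)) has_vector_derivative pd1 F (s, t)) (at s)"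
    and "(s, t) \<in> U \<Longrightarrow> ((\<lambda>t. F (s, t)) has_vector_derivative pd2 F (s, t)) (at t)"
    and "Ck_on k U (pd1 F)" and "Ck_on k U (pd2 F)"
proof -
  note C = assms [unfolded Ck_on.simps(2)]
  show "Ck_on k U (pd1 F)" "Ck_on k U (pd2 F)"
    using C by blast+
  assume "(s, t) \<in> U"
  then have "(\<lambda>s. F (s, t)) differentiable (at s)" "(\<lambda>t. F (s, t)) differentiable (at t)"
    using C by auto
  then show "((\<lambda>s. F (s, t)) has_vector_derivative pd1 F (s, t)) (at s)"
    "((\<lambda>t. F (s, t)) has_vector_derivative pd2 F (s, t)) (at t)"
    unfolding pd1_def pd2_def fst_conv snd_conv by (simp_all only: vector_derivative_works)
qed

lemma Ck_on_mono_Suc: "Ck_on (Suc k) U F \<Longrightarrow> Ck_on k U F"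
proof (induction k arbitrary: F)
  case (Suc k)
  then show ?case
    unfolding Ck_on.simps(2) [of "Suc k"] Ck_on.simps(2) [of k U F] by blast
qed (simp only: Ck_on.simps)

lemma Ck_on_SucI_pd:
  assumes "continuous_on U F"
    and "\<And>s t. (s, t) \<in> U \<Longrightarrow> ((\<lambda>s. F (s, t)) has_vector_derivative F1 (s, t)) (at s)"
    and "\<And>s t. (s, t) \<in> U \<Longrightarrow> ((\<lambda>t. F (s, t)) has_vector_derivative F2 (s, t)) (at t)"
    and "Ck_on k U (pd1 F)" "Ck_on k U (pd2 F)"
  shows "Ck_on (Suc k) U F"
  using assms(1,4,5) differentiableI_vector [OF assms(2)] differentiableI_vector [OF assms(3)]
  by simp

declare Ck_on.simps(2) [simp del]

lemma Ck_on_cong: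
  assumes "open U" "\<And>p. p \<in> U \<Longrightarrow> F p = G p"
  shows "Ck_on k U F \<longleftrightarrow> Ck_on k U G"
proof -
  have imp: "Ck_on k U G" if "Ck_on k U F" "\<forall>p\<in>U. F p = G p" for F G :: "real \<times> real \<Rightarrow> 'a"
    using that
  proof (induction k arbitrary: F G)
    case 0
    then show ?case using continuous_on_cong by auto
  next
    case (Suc k)
    show ?case
    proof (rule Ck_on_SucI_pd)
      show "continuous_on U G"
        using Suc.prems Ck_on_imp_continuous continuous_on_cong by metis
    next
      fix s t assume st: "(s, t) \<in> U"
      show "((\<lambda>s. G (s, t)) has_vector_derivative pd1 F (s, t)) (at s)"
        using Ck_on_SucD(1) [OF Suc.prems(1) st] has_partial1_cong_on [OF \<open>open U\<close> st, of F G]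
          Suc.prems(2) by blast
      show "((\<lambda>t. G (s, t)) has_vector_derivative pd2 F (s, t)) (at t)"
        using Ck_on_SucD(2) [OF Suc.prems(1) st] has_partial2_cong_on [OF \<open>open U\<close> st, of F G]
          Suc.prems(2) by blast
    next
      show "Ck_on k U (pd1 G)"
        using Suc.IH [OF Ck_on_SucD(3) [OF Suc.prems(1)]] pd1_cong_on [OF \<open>open U\<close>, of _ F G]
          Suc.prems(2) by blast
      show "Ck_on k U (pd2 G)"
        using Suc.IH [OF Ck_on_SucD(4) [OF Suc.prems(1)]] pd2_cong_on [OF \<open>open U\<close>, of _ F G]
          Suc.prems(2) by blast
    qed
  qed
  show ?thesis
    using imp [of F G] imp [of G F] assms(2) by auto
qed

text \<open>The introduction rule behind all closure properties: the partial derivatives may be given by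
  any expressions that represent them on the open set.\<close>

lemma Ck_on_SucI:
  assumes "open U" "continuous_on U F"
    and 1: "\<And>s t. (s, t) \<in> U \<Longrightarrow> ((\<lambda>s. F (s, t)) has_vector_derivative F1 (s, t)) (at s)"
    and 2: "\<And>s t. (s, t) \<in> U \<Longrightarrow> ((\<lambda>t. F (s, t)) has_vector_derivative F2 (s, t)) (at t)"
    and "Ck_on k U F1" "Ck_on k U F2"
  shows "Ck_on (Suc k) U F"
proof -
  have "pd1 F p = F1 p" "pd2 F p = F2 p" if "p \<in> U" for p
    using that pd1_eqI [OF 1] pd2_eqI [OF 2] by (cases p; simp)+
  then have "Ck_on k U (pd1 F)" "Ck_on k U (pd2 F)"
    using assms(5,6) Ck_on_cong [OF \<open>open U\<close>] by blast+
  then show ?thesis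
    using Ck_on_SucI_pd [OF assms(2) 1 2] by blast
qed

lemma Ck_on_const: "open U \<Longrightarrow> Ck_on k U (\<lambda>p. a)"
proof (induction k arbitrary: a)
  case (Suc k)
  then show ?case
    by (intro Ck_on_SucI [where ?F1.0 = "\<lambda>p. 0" and ?F2.0 = "\<lambda>p. 0"]) auto
qed auto

lemma Ck_on_add:
  assumes "open U"
  shows "Ck_on k U F \<Longrightarrow> Ck_on k U G \<Longrightarrow> Ck_on k U (\<lambda>p. F p + G p)"
proof (induction k arbitrary: F G)
  case (Suc k)
  note D = Ck_on_SucD [OF Suc.prems(1)] Ck_on_SucD [OF Suc.prems(2)]
  show ?case
  proof (rule Ck_on_SucI [OF assms, where ?F1.0 = "\<lambda>p. pd1 F p + pd1 G p"
        and ?F2.0 = "\<lambda>p. pd2 F p + pd2 G p"])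
    show "continuous_on U (\<lambda>p. F p + G p)"
      by (rule continuous_on_add; rule Ck_on_imp_continuous; rule Suc.prems)
  qed (rule has_vector_derivative_add D Suc.IH; use D in simp)+
qed (simp add: continuous_on_add)

lemma Ck_on_scaleR:
  assumes "open U"
  shows "Ck_on k U a \<Longrightarrow> Ck_on k U V \<Longrightarrow> Ck_on k U (\<lambda>p. a p *\<^sub>R V p)"
proof (induction k arbitrary: a V)
  case (Suc k)
  note mono = Suc.prems [THEN Ck_on_mono_Suc]
  show ?case
  proof (rule Ck_on_SucI [OF assms, where ?F1.0 = "\<lambda>p. a p *\<^sub>R pd1 V p + pd1 a p *\<^sub>R V p"
        and ?F2.0 = "\<lambda>p. a p *\<^sub>R pd2 V p + pd2 a p *\<^sub>R V p"])
    show "continuous_on U (\<lambda>p. a p *\<^sub>R V p)"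
      by (rule continuous_on_scaleR; rule Ck_on_imp_continuous; rule Suc.prems)
  next
    show "Ck_on k U (\<lambda>p. a p *\<^sub>R pd1 V p + pd1 a p *\<^sub>R V p)"
      "Ck_on k U (\<lambda>p. a p *\<^sub>R pd2 V p + pd2 a p *\<^sub>R V p)"
      by (intro Ck_on_add assms Suc.IH mono Ck_on_SucD(3,4) Suc.prems)+
  next
    fix s t assume "(s, t) \<in> U"
    note D = Ck_on_SucD(1,2) [OF Suc.prems(1) this] Ck_on_SucD(1,2) [OF Suc.prems(2) this]
    show "((\<lambda>s. a (s, t) *\<^sub>R V (s, t)) has_vector_derivative
        a (s, t) *\<^sub>R pd1 V (s, t) + pd1 a (s, t) *\<^sub>R V (s, t)) (at s)"
      "((\<lambda>t. a (s, t) *\<^sub>R V (s, t)) has_vector_derivative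
        a (s, t) *\<^sub>R pd2 V (s, t) + pd2 a (s, t) *\<^sub>R V (s, t)) (at t)"
      using D by - (rule has_vector_derivative_scaleR;
          simp add: has_real_derivative_iff_has_vector_derivative)+
  qed
qed (simp add: continuous_on_scaleR)

lemma Ck_on_mult:
  fixes F G :: "real \<times> real \<Rightarrow> real"
  assumes "open U" "Ck_on k U F" "Ck_on k U G"
  shows "Ck_on k U (\<lambda>p. F p * G p)"
  using Ck_on_scaleR [OF assms] by simp

lemma Ck_on_diff:
  assumes "open U" "Ck_on k U F" "Ck_on k U G"
  shows "Ck_on k U (\<lambda>p. F p - G p)"
  using Ck_on_add [OF assms(1,2) Ck_on_scaleR [OF assms(1) Ck_on_const [OF assms(1), of k "-1"] assms(3)]]
  by simp

lemma Ck_on_inverse: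
  fixes F :: "real \<times> real \<Rightarrow> real"
  assumes "open U" and nz: "\<And>p. p \<in> U \<Longrightarrow> F p \<noteq> 0"
  shows "Ck_on k U F \<Longrightarrow> Ck_on k U (\<lambda>p. inverse (F p))"
proof (induction k)
  case (Suc k)
  note IH = Suc.IH [OF Ck_on_mono_Suc [OF Suc.prems]]
  show ?case
  proof (rule Ck_on_SucI [OF assms(1),
        where ?F1.0 = "\<lambda>p. (-1) * (pd1 F p * (inverse (F p) * inverse (F p)))"
        and ?F2.0 = "\<lambda>p. (-1) * (pd2 F p * (inverse (F p) * inverse (F p)))"])
    show "continuous_on U (\<lambda>p. inverse (F p))"
      using Ck_on_imp_continuous [OF Suc.prems] nz by (simp add: continuous_on_inverse)
  next
    fix s t assume st: "(s, t) \<in> U"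
    show "((\<lambda>s. inverse (F (s, t))) has_vector_derivative
        (-1) * (pd1 F (s, t) * (inverse (F (s, t)) * inverse (F (s, t))))) (at s)"
      "((\<lambda>t. inverse (F (s, t))) has_vector_derivative
        (-1) * (pd2 F (s, t) * (inverse (F (s, t)) * inverse (F (s, t))))) (at t)"
      using Ck_on_SucD(1,2) [OF Suc.prems st] nz [OF st]
      unfolding has_real_derivative_iff_has_vector_derivative [symmetric]
      by (auto intro!: derivative_eq_intros)
  next
    show "Ck_on k U (\<lambda>p. (-1) * (pd1 F p * (inverse (F p) * inverse (F p))))"
      "Ck_on k U (\<lambda>p. (-1) * (pd2 F p * (inverse (F p) * inverse (F p))))"
      by (intro Ck_on_mult Ck_on_const \<open>open U\<close> IH Ck_on_SucD(3,4) Suc.prems)+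
  qed
qed (use nz in \<open>simp add: continuous_on_inverse\<close>)

lemma Ck_on_divide:
  fixes F G :: "real \<times> real \<Rightarrow> real"
  assumes "open U" "Ck_on k U F" "Ck_on k U G" "\<And>p. p \<in> U \<Longrightarrow> G p \<noteq> 0"
  shows "Ck_on k U (\<lambda>p. F p / G p)"
  using Ck_on_mult [OF assms(1,2) Ck_on_inverse [OF assms(1,4,3)]] by (simp add: divide_inverse)

section \<open>Linear second order profiles\<close>

text \<open>The inhomogeneous oscillator \<open>h'' = \<alpha> h + \<beta>\<close> at energy \<open>K\<close>. The energy is a parameter because
  the constraint that couples \<open>f\<close> and \<open>g\<close> is a relation between their energies.\<close>

definition profile :: "real \<Rightarrow> real \<Rightarrow> real \<Rightarrow> (real \<Rightarrow> real) \<Rightarrow> (real \<Rightarrow> real) \<Rightarrow> bool" where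
  "profile \<alpha> \<beta> K h h' \<longleftrightarrow>
     (\<forall>x. (h has_real_derivative h' x) (at x) \<and>
          (h' has_real_derivative \<alpha> * h x + \<beta>) (at x) \<and>
          (h' x)\<^sup>2 = \<alpha> * (h x)\<^sup>2 + 2 * \<beta> * h x + K)"

text \<open>The span of \<open>1\<close>, \<open>h\<close> and \<open>h'\<close> is closed under differentiation, so one induction on the order
  treats \<open>h\<close> and \<open>h'\<close> together.\<close>

lemma Ck_on_profile:
  assumes "open U" "profile \<alpha> \<beta> K h h'"
  shows "Ck_on k U (\<lambda>p. h (fst p))" "Ck_on k U (\<lambda>p. h' (fst p))"
    "Ck_on k U (\<lambda>p. h (snd p))" "Ck_on k U (\<lambda>p. h' (snd p))"
proof -
  note P = assms(2) [unfolded profile_def]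
  have cont: "continuous_on A h" "continuous_on A h'" for A
    using P by (auto intro!: DERIV_isCont continuous_at_imp_continuous_on)
  have cont': "continuous_on U (\<lambda>p. h (fst p))" "continuous_on U (\<lambda>p. h' (fst p))"
    "continuous_on U (\<lambda>p. h (snd p))" "continuous_on U (\<lambda>p. h' (snd p))"
    by (auto intro: continuous_on_compose2 [OF cont(1) continuous_on_fst]
        continuous_on_compose2 [OF cont(2) continuous_on_fst]
        continuous_on_compose2 [OF cont(1) continuous_on_snd]
        continuous_on_compose2 [OF cont(2) continuous_on_snd] continuous_on_id)
  have "Ck_on k U (\<lambda>p. h (fst p)) \<and> Ck_on k U (\<lambda>p. h' (fst p)) \<and>
      Ck_on k U (\<lambda>p. h (snd p)) \<and> Ck_on k U (\<lambda>p. h' (snd p))"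
  proof (induction k)
    case (Suc k)
    have c: "Ck_on k U (\<lambda>p. \<alpha> * h (fst p) + \<beta>)" "Ck_on k U (\<lambda>p. \<alpha> * h (snd p) + \<beta>)"
      using Suc by (auto intro!: Ck_on_add Ck_on_mult Ck_on_const \<open>open U\<close>)
    have z: "Ck_on k U (\<lambda>p. 0::real)"
      by (intro Ck_on_const \<open>open U\<close>)
    show ?case
      using P Suc c z cont'
      by (intro conjI Ck_on_SucI [OF \<open>open U\<close> cont'(1) _ _ _ z, where ?F1.0 = "\<lambda>p. h' (fst p)"]
          Ck_on_SucI [OF \<open>open U\<close> cont'(2) _ _ _ z, where ?F1.0 = "\<lambda>p. \<alpha> * h (fst p) + \<beta>"]
          Ck_on_SucI [OF \<open>open U\<close> cont'(3) _ _ z, where ?F2.0 = "\<lambda>p. h' (snd p)"]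
          Ck_on_SucI [OF \<open>open U\<close> cont'(4) _ _ z, where ?F2.0 = "\<lambda>p. \<alpha> * h (snd p) + \<beta>"])
        (auto simp: has_real_derivative_iff_has_vector_derivative)
  qed (use cont' in auto)
  then show "Ck_on k U (\<lambda>p. h (fst p))" "Ck_on k U (\<lambda>p. h' (fst p))"
    "Ck_on k U (\<lambda>p. h (snd p))" "Ck_on k U (\<lambda>p. h' (snd p))"
    by auto
qed

text \<open>Moving the equilibrium \<open>- \<beta> / \<alpha>\<close> to the origin turns the energy identity into the one of a
  homogeneous oscillator with amplitude \<open>r\<close>, where it is the Pythagorean identity for \<open>cosh\<close> or
  \<open>sin\<close>.\<close>

lemma energy_eq_shifted_square:
  fixes \<alpha> :: real
  assumes "\<alpha> \<noteq> 0"
  shows "\<alpha> * (y - \<beta> / \<alpha>)\<^sup>2 + 2 * \<beta> * (y - \<beta> / \<alpha>) + (\<beta>\<^sup>2 / \<alpha> - \<alpha> * r\<^sup>2) = \<alpha> * (y\<^sup>2 - r\<^sup>2)"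
  using assms by (simp add: field_simps power2_eq_square)

lemma profile_cosh:
  fixes q r :: real
  assumes "q\<^sup>2 = \<alpha>" "\<alpha> \<noteq> 0"
  shows "profile \<alpha> \<beta> (\<beta>\<^sup>2 / \<alpha> - \<alpha> * r\<^sup>2)
    (\<lambda>u. r * cosh (q * u) - \<beta> / \<alpha>) (\<lambda>u. r * q * sinh (q * u))"
proof -
  have a: "\<alpha> = q * q" using assms(1) by (simp add: power2_eq_square)
  have "(r * q * sinh (q * x))\<^sup>2 =
      \<alpha> * (r * cosh (q * x) - \<beta> / \<alpha>)\<^sup>2 + 2 * \<beta> * (r * cosh (q * x) - \<beta> / \<alpha>) + (\<beta>\<^sup>2 / \<alpha> - \<alpha> * r\<^sup>2)"
    for x
  proof -
    have "(r * q * sinh (q * x))\<^sup>2 = \<alpha> * (r\<^sup>2 * (cosh (q * x))\<^sup>2 - r\<^sup>2)"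
      by (simp add: power_mult_distrib assms(1) sinh_square_eq algebra_simps)
    then show ?thesis
      unfolding energy_eq_shifted_square [OF assms(2)] by (simp add: power_mult_distrib)
  qed
  moreover have "((\<lambda>u. r * cosh (q * u) - \<beta> / \<alpha>) has_real_derivative r * q * sinh (q * x)) (at x)" for x
    by (auto intro!: derivative_eq_intros)
  moreover have "((\<lambda>u. r * q * sinh (q * u)) has_real_derivative
      \<alpha> * (r * cosh (q * x) - \<beta> / \<alpha>) + \<beta>) (at x)" for x
  proof -
    have "\<alpha> * (r * cosh (q * x) - \<beta> / \<alpha>) + \<beta> = \<alpha> * (r * cosh (q * x))"
      using assms(2) by (simp add: right_diff_distrib)
    then show ?thesis
      by (auto intro!: derivative_eq_intros simp: a)
  qed
  ultimately show ?thesis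
    unfolding profile_def by blast
qed

lemma profile_sin:
  fixes q r :: real
  assumes "q\<^sup>2 = - \<alpha>" "\<alpha> \<noteq> 0"
  shows "profile \<alpha> \<beta> (\<beta>\<^sup>2 / \<alpha> - \<alpha> * r\<^sup>2)
    (\<lambda>u. r * sin (q * u) - \<beta> / \<alpha>) (\<lambda>u. r * q * cos (q * u))"
proof -
  have a: "\<alpha> = - q * q" using assms(1) by (simp add: power2_eq_square)
  have "(r * q * cos (q * x))\<^sup>2 =
      \<alpha> * (r * sin (q * x) - \<beta> / \<alpha>)\<^sup>2 + 2 * \<beta> * (r * sin (q * x) - \<beta> / \<alpha>) + (\<beta>\<^sup>2 / \<alpha> - \<alpha> * r\<^sup>2)"
    for x
  proof -
    have "(r * q * cos (q * x))\<^sup>2 = \<alpha> * (r\<^sup>2 * (sin (q * x))\<^sup>2 - r\<^sup>2)"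
      by (simp add: power_mult_distrib assms(1) cos_squared_eq algebra_simps)
    then show ?thesis
      unfolding energy_eq_shifted_square [OF assms(2)] by (simp add: power_mult_distrib)
  qed
  moreover have "((\<lambda>u. r * sin (q * u) - \<beta> / \<alpha>) has_real_derivative r * q * cos (q * x)) (at x)" for x
    by (auto intro!: derivative_eq_intros)
  moreover have "((\<lambda>u. r * q * cos (q * u)) has_real_derivative
      \<alpha> * (r * sin (q * x) - \<beta> / \<alpha>) + \<beta>) (at x)" for x
  proof -
    have "\<alpha> * (r * sin (q * x) - \<beta> / \<alpha>) + \<beta> = \<alpha> * (r * sin (q * x))"
      using assms(2) by (simp add: right_diff_distrib)
    then show ?thesis
      by (auto intro!: derivative_eq_intros simp: a)
  qed
  ultimately show ?thesis
    unfolding profile_def by blast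
qed

section \<open>Pairs of profiles with opposite energies\<close>

text \<open>The opposite energies \<open>K\<close> and \<open>- K\<close> stand for the algebraic constraint on the amplitudes in
  every one of the four kinds of data.\<close>

locale profile_pair =
  fixes b c K :: real and f f' g g' :: "real \<Rightarrow> real"
  assumes f: "profile c b K f f'" and g: "profile (- (1 + c)) b (- K) g g'"
begin

lemma DERIV_f [derivative_intros]: "(f has_real_derivative f' x) (at x)"
  and DERIV_f' [derivative_intros]: "(f' has_real_derivative c * f x + b) (at x)"
  and DERIV_g [derivative_intros]: "(g has_real_derivative g' x) (at x)"
  and DERIV_g' [derivative_intros]: "(g' has_real_derivative b - (1 + c) * g x) (at x)"
  using f g by (simp_all add: profile_def algebra_simps)

lemma first_integral:
  "(f' u)\<^sup>2 + (g' v)\<^sup>2 + (g v)\<^sup>2 = (f u + g v) * (2 * b + c * (f u - g v))"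
proof -
  have "(f' u)\<^sup>2 = c * (f u)\<^sup>2 + 2 * b * f u + K" "(g' v)\<^sup>2 = - (1 + c) * (g v)\<^sup>2 + 2 * b * g v - K"
    using f g by (auto simp: profile_def)
  then show ?thesis
    by (simp add: algebra_simps power2_eq_square)
qed

text \<open>This duality exchanges \<open>f + g\<close> and \<open>M\<close> up to constants: it sends \<open>f + g\<close> to \<open>M\<close> and \<open>M\<close> to
  \<open>c\<^sup>2 (f + g)\<close>. The conformal factor \<open>c (f + g) / M\<close> is thereby inverted, as under the Christoffel
  transformation of isothermic surfaces.\<close>

lemma dual: "profile_pair (- c * b) c (c\<^sup>2 * K)
  (\<lambda>u. c * f u + 2 * b) (\<lambda>u. c * f' u) (\<lambda>v. - c * g v) (\<lambda>v. - c * g' v)"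
proof
  have e: "(f' x)\<^sup>2 = c * (f x)\<^sup>2 + 2 * b * f x + K" for x
    using f by (auto simp: profile_def)
  have "(c * f' x)\<^sup>2 = c * (c * f x + 2 * b)\<^sup>2 + 2 * (- c * b) * (c * f x + 2 * b) + c\<^sup>2 * K" for x
    using e [of x] by algebra
  then show "profile c (- c * b) (c\<^sup>2 * K) (\<lambda>u. c * f u + 2 * b) (\<lambda>u. c * f' u)"
    unfolding profile_def by (auto intro!: derivative_eq_intros simp: algebra_simps)
  have e: "(g' x)\<^sup>2 = - (1 + c) * (g x)\<^sup>2 + 2 * b * g x - K" for x
    using g by (auto simp: profile_def)
  have "(- c * g' x)\<^sup>2 = - (1 + c) * (- c * g x)\<^sup>2 + 2 * (- c * b) * (- c * g x) + - (c\<^sup>2 * K)" for x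
    using e [of x] by algebra
  then show "profile (- (1 + c)) (- c * b) (- (c\<^sup>2 * K)) (\<lambda>v. - c * g v) (\<lambda>v. - c * g' v)"
    unfolding profile_def by (auto intro!: derivative_eq_intros simp: algebra_simps)
qed

end

text \<open>By partial fractions, \<open>b\<^sup>2 / (c (1 + c)) = b\<^sup>2 / c - b\<^sup>2 / (1 + c)\<close>; this is how the constraint
  becomes a statement about the two energies.\<close>

lemma energies_cancel:
  fixes b c :: real
  assumes "c \<noteq> 0" "1 + c \<noteq> 0" "b\<^sup>2 / (c * (1 + c)) = c * A - (1 + c) * B"
  shows "b\<^sup>2 / (- (1 + c)) - (- (1 + c)) * B = - (b\<^sup>2 / c - c * A)"
proof -
  have "b\<^sup>2 / (c * (1 + c)) = b\<^sup>2 / c - b\<^sup>2 / (1 + c)"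
    using assms(1,2) by (simp add: divide_simps) (simp add: algebra_simps)
  moreover have "b\<^sup>2 / (- (1 + c)) = - (b\<^sup>2 / (1 + c))"
    by (rule minus_divide_right [symmetric])
  ultimately show ?thesis
    using assms(3) by (simp add: algebra_simps)
qed

text \<open>The amplitude of a \<open>cosh\<close> is not assumed to be positive; the constraint forces it to be. This
  matters because the energy contains \<open>(sqrt A1)\<^sup>2\<close>, which has to be \<open>A1\<close>. For \<open>c = -1\<close> the function
  \<open>g\<close> is a parabola, the motion under the constant force \<open>b\<close>.\<close>

lemma associated_data_profile_pair:
  assumes "associated_data b c f g"
  obtains K f' g' where "profile_pair b c K f f' g g'"
  using assms
proof cases
  case (pos B1 A1)
  have "c * A1 > 0"
    using pos(1-3) by (smt (verit) divide_nonneg_pos mult_pos_pos zero_le_power2)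
  then have A1: "A1 > 0" using pos(1) by (simp add: zero_less_mult_iff)
  have f: "profile c b (b\<^sup>2 / c - c * A1) f (\<lambda>u. sqrt A1 * sqrt c * sinh (sqrt c * u))"
    using profile_cosh [of "sqrt c" c b "sqrt A1"] pos A1 by simp
  have g: "profile (- (1 + c)) b (b\<^sup>2 / (- (1 + c)) - (- (1 + c)) * B1) g
      (\<lambda>u. sqrt B1 * sqrt (1 + c) * cos (sqrt (1 + c) * u))"
    using profile_sin [of "sqrt (1 + c)" "- (1 + c)" b "sqrt B1"] pos
    by (simp add: divide_minus_right del: minus_add_distrib)
  have "b\<^sup>2 / (- (1 + c)) - (- (1 + c)) * B1 = - (b\<^sup>2 / c - c * A1)"
    using pos(1,3) by (intro energies_cancel) auto
  then show thesis
    using that f g by (metis profile_pair.intro)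
next
  case (between A1 B1)
  have f: "profile c b (b\<^sup>2 / c - c * A1) f (\<lambda>u. sqrt A1 * sqrt (- c) * cos (sqrt (- c) * u))"
    using profile_sin [of "sqrt (- c)" c b "sqrt A1"] between by simp
  have g: "profile (- (1 + c)) b (b\<^sup>2 / (- (1 + c)) - (- (1 + c)) * B1) g
      (\<lambda>u. sqrt B1 * sqrt (1 + c) * cos (sqrt (1 + c) * u))"
    using profile_sin [of "sqrt (1 + c)" "- (1 + c)" b "sqrt B1"] between
    by (simp add: divide_minus_right del: minus_add_distrib)
  have "b\<^sup>2 / (- (1 + c)) - (- (1 + c)) * B1 = - (b\<^sup>2 / c - c * A1)"
    using between(1,2,5) by (intro energies_cancel) auto
  then show thesis
    using that f g by (metis profile_pair.intro)
next
  case (below A1 B1)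
  have "c * A1 < 0" "b\<^sup>2 / (c * (1 + c)) \<ge> 0"
    using below(1,2) by (auto simp: mult_less_0_iff intro!: divide_nonneg_pos mult_neg_neg)
  then have "(1 + c) * B1 < 0" using below(3) by linarith
  then have B1: "B1 > 0" using below(1) by (simp add: mult_less_0_iff)
  have f: "profile c b (b\<^sup>2 / c - c * A1) f (\<lambda>u. sqrt A1 * sqrt (- c) * cos (sqrt (- c) * u))"
    using profile_sin [of "sqrt (- c)" c b "sqrt A1"] below by simp
  have g: "profile (- (1 + c)) b (b\<^sup>2 / (- (1 + c)) - (- (1 + c)) * B1) g
      (\<lambda>u. sqrt B1 * sqrt (- 1 - c) * sinh (sqrt (- 1 - c) * u))"
    using profile_cosh [of "sqrt (- 1 - c)" "- (1 + c)" b "sqrt B1"] below B1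
    by (simp add: divide_minus_right del: minus_add_distrib)
  have "b\<^sup>2 / (- (1 + c)) - (- (1 + c)) * B1 = - (b\<^sup>2 / c - c * A1)"
    using below(1,3) by (intro energies_cancel) auto
  then show thesis
    using that f g by (metis profile_pair.intro)
next
  case (minus_one A1 a2 b2)
  have f: "profile c b (A1 - b\<^sup>2) f (\<lambda>u. sqrt A1 * cos u)"
    using profile_sin [of 1 c b "sqrt A1"] minus_one by simp
  have "a2\<^sup>2 - 2 * b * b2 = - (A1 - b\<^sup>2)"
    using minus_one(3) by (simp add: power2_eq_square algebra_simps)
  then have g: "profile (- (1 + c)) b (- (A1 - b\<^sup>2)) g (\<lambda>u. b * u + a2)"
    unfolding profile_def minus_one(1,5)
    by (auto intro!: derivative_eq_intros simp: power2_eq_square field_simps)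
  show thesis
    using that f g by (metis profile_pair.intro)
qed

section \<open>Solutions of the Calapso equation\<close>

lemma pd1_eq_realI:
  fixes F :: "real \<times> real \<Rightarrow> real"
  shows "((\<lambda>s. F (s, t)) has_real_derivative D) (at s) \<Longrightarrow> D = d \<Longrightarrow> pd1 F (s, t) = d"
  by (simp add: pd1_eqI has_real_derivative_iff_has_vector_derivative)

lemma pd2_eq_realI:
  fixes F :: "real \<times> real \<Rightarrow> real"
  shows "((\<lambda>t. F (s, t)) has_real_derivative D) (at t) \<Longrightarrow> D = d \<Longrightarrow> pd2 F (s, t) = d"
  by (simp add: pd2_eqI has_real_derivative_iff_has_vector_derivative)

context profile_pair
begin

text \<open>The quotient \<open>w\<^sub>1\<^sub>2 / w = 2 f' g' / (f + g)\<^sup>2\<close> is independent of \<open>k\<close>, whereas \<open>w\<^sup>2\<close> carries the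
  factor \<open>k\<^sup>2\<close>, which must be \<open>1 / 2\<close> for the terms to balance. Each term then equals
  \<open>2 f' g' / (f + g)\<^sup>4\<close> times one of three brackets. The brackets add up to
  \<open>- (f + g)\<^sup>2 - 6 (f'' + g'') (f + g) + 6 (f'\<^sup>2 + g'\<^sup>2) + f\<^sup>2 - 4 f g + g\<^sup>2\<close>, and since
  \<open>f'' + g'' = M - g\<close> and \<open>f'\<^sup>2 + g'\<^sup>2 = (f + g) M - g\<^sup>2\<close>, this is zero.\<close>

lemma calapso_quotient:
  assumes "open U" and k: "k\<^sup>2 = 1 / 2"
    and S: "\<And>p. p \<in> U \<Longrightarrow> f (fst p) + g (snd p) \<noteq> 0"
    and D: "\<And>p. p \<in> U \<Longrightarrow> f (fst p) - g (snd p) \<noteq> 0"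
  shows "calapso_solution_on U (\<lambda>p. k * (f (fst p) - g (snd p)) / (f (fst p) + g (snd p)))"
proof -
  define w where "w = (\<lambda>p. k * (f (fst p) - g (snd p)) / (f (fst p) + g (snd p)))"
  define w1 where "w1 = (\<lambda>p. 2 * k * f' (fst p) * g (snd p) / (f (fst p) + g (snd p))\<^sup>2)"
  define w12 where "w12 = (\<lambda>p. 2 * k * f' (fst p) * g' (snd p) * (f (fst p) - g (snd p)) /
      (f (fst p) + g (snd p)) ^ 3)"
  define Q where "Q = (\<lambda>p. 2 * f' (fst p) * g' (snd p) / (f (fst p) + g (snd p))\<^sup>2)"
  define Q1 where "Q1 = (\<lambda>p. 2 * g' (snd p) * ((c * f (fst p) + b) * (f (fst p) + g (snd p))
      - 2 * (f' (fst p))\<^sup>2) / (f (fst p) + g (snd p)) ^ 3)"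
  define Q2 where "Q2 = (\<lambda>p. 2 * f' (fst p) * ((b - (1 + c) * g (snd p)) * (f (fst p) + g (snd p))
      - 2 * (g' (snd p))\<^sup>2) / (f (fst p) + g (snd p)) ^ 3)"
  define Q11 where "Q11 = (\<lambda>p. 2 * f' (fst p) * g' (snd p) * (c * (f (fst p) + g (snd p))\<^sup>2
      - 6 * (c * f (fst p) + b) * (f (fst p) + g (snd p)) + 6 * (f' (fst p))\<^sup>2) /
      (f (fst p) + g (snd p)) ^ 4)"
  define Q22 where "Q22 = (\<lambda>p. 2 * f' (fst p) * g' (snd p) * (- (1 + c) * (f (fst p) + g (snd p))\<^sup>2
      - 6 * (b - (1 + c) * g (snd p)) * (f (fst p) + g (snd p)) + 6 * (g' (snd p))\<^sup>2) /
      (f (fst p) + g (snd p)) ^ 4)"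
  define P1 where "P1 = (\<lambda>p. 2 * f' (fst p) * g (snd p) * (f (fst p) - g (snd p)) /
      (f (fst p) + g (snd p)) ^ 3)"
  define P12 where "P12 = (\<lambda>p. 2 * f' (fst p) * g' (snd p) *
      ((f (fst p))\<^sup>2 - 4 * f (fst p) * g (snd p) + (g (snd p))\<^sup>2) / (f (fst p) + g (snd p)) ^ 4)"
  \<comment> \<open>The \<open>Q\<close> family are the derivatives of the quotient, the \<open>P\<close> family those of the square.\<close>
  note fn_defs = w_def w1_def w12_def Q_def Q1_def Q2_def Q11_def Q22_def P1_def P12_def
  have pds: "pd1 w (s, t) = w1 (s, t)" "pd2 w1 (s, t) = w12 (s, t)"
    "pd1 Q (s, t) = Q1 (s, t)" "pd2 Q (s, t) = Q2 (s, t)"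
    "pd1 Q1 (s, t) = Q11 (s, t)" "pd2 Q2 (s, t) = Q22 (s, t)"
    "pd1 (\<lambda>q. (w q)\<^sup>2) (s, t) = P1 (s, t)" "pd2 P1 (s, t) = P12 (s, t)"
    if "(s, t) \<in> U" for s t
  proof -
    have k2: "2 * k\<^sup>2 = 1" using k by simp
    have nz: "f s + g t \<noteq> 0"
      using S [OF that] by simp
    show "pd1 w (s, t) = w1 (s, t)"
      unfolding fn_defs fst_conv snd_conv
      by (rule pd1_eq_realI, unfold fst_conv snd_conv,
          (rule derivative_eq_intros refl | simp add: nz)+, simp add: nz divide_simps, algebra?)
    show "pd2 w1 (s, t) = w12 (s, t)"
      unfolding fn_defs fst_conv snd_conv
      by (rule pd2_eq_realI, unfold fst_conv snd_conv,
          (rule derivative_eq_intros refl | simp add: nz)+, simp add: nz divide_simps, algebra?)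
    show "pd1 Q (s, t) = Q1 (s, t)"
      unfolding fn_defs fst_conv snd_conv
      by (rule pd1_eq_realI, unfold fst_conv snd_conv,
          (rule derivative_eq_intros refl | simp add: nz)+, simp add: nz divide_simps, algebra?)
    show "pd2 Q (s, t) = Q2 (s, t)"
      unfolding fn_defs fst_conv snd_conv
      by (rule pd2_eq_realI, unfold fst_conv snd_conv,
          (rule derivative_eq_intros refl | simp add: nz)+, simp add: nz divide_simps, algebra?)
    show "pd1 Q1 (s, t) = Q11 (s, t)"
      unfolding fn_defs fst_conv snd_conv
      by (rule pd1_eq_realI, unfold fst_conv snd_conv,
          (rule derivative_eq_intros refl | simp add: nz)+, simp add: nz divide_simps, algebra?)
    show "pd2 Q2 (s, t) = Q22 (s, t)"
      unfolding fn_defs fst_conv snd_conv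
      by (rule pd2_eq_realI, unfold fst_conv snd_conv,
          (rule derivative_eq_intros refl | simp add: nz)+, simp add: nz divide_simps, algebra?)
    show "pd1 (\<lambda>q. (w q)\<^sup>2) (s, t) = P1 (s, t)"
      unfolding fn_defs fst_conv snd_conv
      by (rule pd1_eq_realI, unfold fst_conv snd_conv,
          (rule derivative_eq_intros refl | simp add: nz)+, simp add: nz divide_simps,
          (use k2 in algebra)?)
    show "pd2 P1 (s, t) = P12 (s, t)"
      unfolding fn_defs fst_conv snd_conv
      by (rule pd2_eq_realI, unfold fst_conv snd_conv,
          (rule derivative_eq_intros refl | simp add: nz)+, simp add: nz divide_simps, algebra?)
  qed
  have w: "pd1 w p = w1 p" "pd2 w1 p = w12 p" if "p \<in> U" for p
    using pds that by (cases p; simp)+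
  have Q: "pd1 Q p = Q1 p" "pd2 Q p = Q2 p" "pd1 Q1 p = Q11 p" "pd2 Q2 p = Q22 p" if "p \<in> U" for p
    using pds that by (cases p; simp)+
  have P: "pd1 (\<lambda>q. (w q)\<^sup>2) p = P1 p" "pd2 P1 p = P12 p" if "p \<in> U" for p
    using pds that by (cases p; simp)+
  have ratio: "pd2 (pd1 w) p / w p = Q p" if "p \<in> U" for p
  proof -
    have "k \<noteq> 0" using k by auto
    then have "w12 p / w p = Q p"
      using S [OF that] D [OF that]
      by (simp add: fn_defs divide_simps power2_eq_square power3_eq_cube)
    moreover have "pd2 (pd1 w) p = w12 p"
      using pd2_cong_on [OF \<open>open U\<close> that, of "pd1 w" w1] w that by simp
    ultimately show ?thesis
      by simp
  qed
  have pde: "Q11 p + Q22 p + P12 p = 0" if "p \<in> U" for p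
  proof -
    obtain s t where p: "p = (s, t)" by force
    have "c * (f s + g t)\<^sup>2 - 6 * (c * f s + b) * (f s + g t) + 6 * (f' s)\<^sup>2
        + (- (1 + c) * (f s + g t)\<^sup>2 - 6 * (b - (1 + c) * g t) * (f s + g t) + 6 * (g' t)\<^sup>2)
        + ((f s)\<^sup>2 - 4 * f s * g t + (g t)\<^sup>2) = 0"
      using first_integral [of s t] by algebra
    then show ?thesis
      unfolding fn_defs p fst_conv snd_conv add_divide_distrib [symmetric] distrib_left [symmetric]
      by simp
  qed
  have "pd1 (pd1 (\<lambda>q. pd2 (pd1 w) q / w q)) p + pd2 (pd2 (\<lambda>q. pd2 (pd1 w) q / w q)) p
      + pd2 (pd1 (\<lambda>q. (w q)\<^sup>2)) p = 0" if "p \<in> U" for p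
  proof -
    note cong1 = pd1_cong_on [OF \<open>open U\<close>] and cong2 = pd2_cong_on [OF \<open>open U\<close>]
    have "pd1 (pd1 (\<lambda>q. pd2 (pd1 w) q / w q)) p = Q11 p"
      using cong1 [OF that, of "pd1 (\<lambda>q. pd2 (pd1 w) q / w q)" Q1]
        cong1 [of _ "\<lambda>q. pd2 (pd1 w) q / w q" Q] ratio Q that by simp
    moreover have "pd2 (pd2 (\<lambda>q. pd2 (pd1 w) q / w q)) p = Q22 p"
      using cong2 [OF that, of "pd2 (\<lambda>q. pd2 (pd1 w) q / w q)" Q2]
        cong2 [of _ "\<lambda>q. pd2 (pd1 w) q / w q" Q] ratio Q that by simp
    moreover have "pd2 (pd1 (\<lambda>q. (w q)\<^sup>2)) p = P12 p"
      using cong2 [OF that, of "pd1 (\<lambda>q. (w q)\<^sup>2)" P1] P that by simp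
    ultimately show ?thesis
      using pde [OF that] by simp
  qed
  moreover have "Ck_on 4 U w"
    unfolding w_def using S
    by (intro Ck_on_divide Ck_on_mult Ck_on_add Ck_on_diff Ck_on_const
        Ck_on_profile [OF _ f] Ck_on_profile [OF _ g] \<open>open U\<close>)
  moreover have "\<forall>p\<in>U. w p \<noteq> 0"
    using k S D by (auto simp: w_def)
  ultimately show ?thesis
    using \<open>open U\<close> unfolding calapso_solution_on_def w_def by blast
qed

lemma open_nonzero_combination: "open {p. \<alpha> + \<beta> * f (fst p) + \<gamma> * g (snd p) \<noteq> 0}"
proof -
  have "continuous_on UNIV (\<lambda>p. \<alpha> + \<beta> * f (fst p) + \<gamma> * g (snd p))"
    by (intro Ck_on_imp_continuous [of 0] Ck_on_mult Ck_on_add Ck_on_const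
        Ck_on_profile [OF _ f] Ck_on_profile [OF _ g] open_UNIV)
  then show ?thesis
    by (intro open_Collect_neq) auto
qed

lemma open_assoc_domain: "open (assoc_domain b c f g)"
proof -
  have "assoc_domain b c f g = {p. 0 + 1 * f (fst p) + 1 * g (snd p) \<noteq> 0}
      \<inter> {p. 2 * b + c * f (fst p) + (- c) * g (snd p) \<noteq> 0}"
    by (auto simp: assoc_domain_def assoc_M_def algebra_simps)
  then show ?thesis
    using open_Int [OF open_nonzero_combination [of 0 1 1] open_nonzero_combination [of "2 * b" c "- c"]]
    by (simp only:)
qed

lemma calapso_Omega:
  "calapso_solution_on {p \<in> assoc_domain b c f g. assoc_Omega c f g p \<noteq> 0} (assoc_Omega c f g)"
proof -
  have Omega: "assoc_Omega c f g =
      (\<lambda>p. (eps c * sqrt 2 / 2) * (f (fst p) - g (snd p)) / (f (fst p) + g (snd p)))"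
    by (simp add: assoc_Omega_def fun_eq_iff)
  have "{p \<in> assoc_domain b c f g. assoc_Omega c f g p \<noteq> 0} =
      assoc_domain b c f g \<inter> {p. 0 + 1 * f (fst p) + (- 1) * g (snd p) \<noteq> 0}"
    by (auto simp: assoc_domain_def Omega eps_def)
  then have "open {p \<in> assoc_domain b c f g. assoc_Omega c f g p \<noteq> 0}"
    using open_Int [OF open_assoc_domain open_nonzero_combination [of 0 1 "- 1"]] by (simp only:)
  then show ?thesis
    unfolding Omega
    by (rule calapso_quotient) (auto simp: assoc_domain_def eps_def power_divide power_mult_distrib)
qed

text \<open>For the dual pair the quotient \<open>(f - g) / (f + g)\<close> reads \<open>(2 b + c (f + g)) / M\<close>.\<close>

lemma calapso_omega:
  assumes "c \<noteq> 0"
  shows "calapso_solution_on {p \<in> assoc_domain b c f g. assoc_omega b c f g p \<noteq> 0}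
    (assoc_omega b c f g)"
proof -
  interpret dual: profile_pair "- c * b" c "c\<^sup>2 * K"
      "\<lambda>u. c * f u + 2 * b" "\<lambda>u. c * f' u" "\<lambda>v. - c * g v" "\<lambda>v. - c * g' v"
    by (rule dual)
  have omega: "assoc_omega b c f g = (\<lambda>p. (eps c * sqrt 2 / 2) *
      ((c * f (fst p) + 2 * b) - - c * g (snd p)) / ((c * f (fst p) + 2 * b) + - c * g (snd p)))"
  proof
    fix p
    have M: "assoc_M b c f g p = (c * f (fst p) + 2 * b) + - c * g (snd p)"
      and "assoc_M b c f g p + 2 * c * g (snd p) = (c * f (fst p) + 2 * b) - - c * g (snd p)"
      by (simp_all add: assoc_M_def algebra_simps)
    then show "assoc_omega b c f g p = (eps c * sqrt 2 / 2) *
      ((c * f (fst p) + 2 * b) - - c * g (snd p)) / ((c * f (fst p) + 2 * b) + - c * g (snd p))"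
      unfolding assoc_omega_def by (simp only: M times_divide_eq_left divide_divide_eq_left)
  qed
  have num: "assoc_M b c f g p + 2 * c * g (snd p) = 2 * b + c * f (fst p) + c * g (snd p)" for p
    by (simp add: assoc_M_def algebra_simps)
  have "assoc_omega b c f g p \<noteq> 0 \<longleftrightarrow> 2 * b + c * f (fst p) + c * g (snd p) \<noteq> 0"
    if "p \<in> assoc_domain b c f g" for p
    using that by (simp add: assoc_omega_def eps_def assoc_domain_def flip: num)
  then have dom: "{p \<in> assoc_domain b c f g. assoc_omega b c f g p \<noteq> 0} =
      assoc_domain b c f g \<inter> {p. 2 * b + c * f (fst p) + c * g (snd p) \<noteq> 0}"
    by auto
  have "open (assoc_domain b c f g \<inter> {p. 2 * b + c * f (fst p) + c * g (snd p) \<noteq> 0})"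
    using open_Int [OF open_assoc_domain open_nonzero_combination [of "2 * b" c c]] by (simp only:)
  then show ?thesis
    unfolding dom unfolding omega
    by (rule dual.calapso_quotient)
      (auto simp: assoc_domain_def assoc_M_def eps_def power_divide power_mult_distrib algebra_simps)
qed

end

section \<open>The fundamental forms of the associated surface\<close>

lemma vector3_eq_axes:
  "(vector [x, y, z] :: real ^ 3) = x *\<^sub>R axis 1 1 + y *\<^sub>R axis 2 1 + z *\<^sub>R axis 3 1"
  by (simp add: vec_eq_iff forall_3 axis_def)

lemma has_vector_derivative_vector3:
  assumes "(x has_real_derivative x') F" "(y has_real_derivative y') F" "(z has_real_derivative z') F"
  shows "((\<lambda>u. vector [x u, y u, z u] :: real ^ 3) has_vector_derivative vector [x', y', z']) F"
  using assms unfolding vector3_eq_axes has_real_derivative_iff_has_vector_derivative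
  by (intro has_vector_derivative_add bounded_linear.has_vector_derivative [OF bounded_linear_scaleR_left])

lemma Ck_on_vector3:
  assumes "open U" "Ck_on k U x" "Ck_on k U y" "Ck_on k U z"
  shows "Ck_on k U (\<lambda>p. vector [x p, y p, z p] :: real ^ 3)"
  unfolding vector3_eq_axes by (intro Ck_on_add Ck_on_scaleR Ck_on_const assms)

lemma has_vector_derivative_cylinder:
  "((\<lambda>s. cylinder (s, t)) has_vector_derivative vector [0, 0, 1]) (at s)"
  "((\<lambda>t. cylinder (s, t)) has_vector_derivative vector [- sin t, cos t, 0]) (at t)"
  unfolding cylinder_def fst_conv snd_conv
  by (rule has_vector_derivative_vector3; auto intro!: derivative_eq_intros)+

lemma pd_cylinder:
  "pd1 cylinder (s, t) = vector [0, 0, 1]" "pd2 cylinder (s, t) = vector [- sin t, cos t, 0]"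
  by (intro pd1_eqI pd2_eqI has_vector_derivative_cylinder)+

lemma profile_sin_cos: "profile (- 1) 0 1 sin cos"
  unfolding profile_def by (auto intro!: derivative_eq_intros simp: cos_squared_eq)

lemma profile_id: "profile 0 0 1 (\<lambda>x. x) (\<lambda>x. 1)"
  unfolding profile_def by auto

context profile_pair
begin

text \<open>The vector along which the tangent planes of the cylinder are reflected. With \<open>E\<^sub>1\<close>, \<open>E\<^sub>2\<close>
  the coordinate vectors and \<open>N\<close> the normal of the cylinder, its derivatives are tangent to the
  parameter lines: since \<open>E\<^sub>2\<close> turns into \<open>N\<close>, the term \<open>g' E\<^sub>2\<close> contributes \<open>g' N\<close>, which is cancelled
  by the change of the coefficient in \<open>- g N\<close>.\<close>

definition direction :: surface where
  "direction p = f' (fst p) *\<^sub>R pd1 cylinder p + g' (snd p) *\<^sub>R pd2 cylinder p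
     - g (snd p) *\<^sub>R cylinder_normal p"

lemma direction_has_derivative:
  "((\<lambda>s. direction (s, t)) has_vector_derivative (c * f s + b) *\<^sub>R pd1 cylinder (s, t)) (at s)"
  "((\<lambda>t. direction (s, t)) has_vector_derivative (b - c * g t) *\<^sub>R pd2 cylinder (s, t)) (at t)"
proof -
  have dir: "direction (s, t) = vector [- g' t * sin t + g t * cos t, g' t * cos t + g t * sin t, f' s]"
    for s t
    by (simp add: direction_def pd_cylinder cylinder_normal_def vec_eq_iff forall_3)
  have 1: "(c * f s + b) *\<^sub>R pd1 cylinder (s, t) = vector [0, 0, c * f s + b]"
    by (simp add: pd_cylinder vec_eq_iff forall_3)
  have 2: "(b - c * g t) *\<^sub>R pd2 cylinder (s, t) = vector [- (b - c * g t) * sin t, (b - c * g t) * cos t, 0]"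
    by (simp add: pd_cylinder vec_eq_iff forall_3 algebra_simps)
  show "((\<lambda>s. direction (s, t)) has_vector_derivative (c * f s + b) *\<^sub>R pd1 cylinder (s, t)) (at s)"
    unfolding dir 1 by (rule has_vector_derivative_vector3; auto intro!: derivative_eq_intros)
  show "((\<lambda>t. direction (s, t)) has_vector_derivative (b - c * g t) *\<^sub>R pd2 cylinder (s, t)) (at t)"
    unfolding dir 2
    by (rule has_vector_derivative_vector3; auto intro!: derivative_eq_intros simp: algebra_simps)
qed

lemma inner_direction:
  "pd1 cylinder p \<bullet> direction p = f' (fst p)" "direction p \<bullet> pd1 cylinder p = f' (fst p)"
  "pd2 cylinder p \<bullet> direction p = g' (snd p)" "direction p \<bullet> pd2 cylinder p = g' (snd p)"
  "direction p \<bullet> direction p = (f (fst p) + g (snd p)) * assoc_M b c f g p"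
  "pd1 cylinder p \<bullet> pd1 cylinder p = 1" "pd2 cylinder p \<bullet> pd2 cylinder p = 1"
  "pd1 cylinder p \<bullet> pd2 cylinder p = 0"  "pd2 cylinder p \<bullet> pd1 cylinder p = 0"
proof -
  obtain s t where p: "p = (s, t)" by force
  have tt: "(sin t)\<^sup>2 + (cos t)\<^sup>2 = 1" by simp
  show "pd1 cylinder p \<bullet> pd1 cylinder p = 1" "pd2 cylinder p \<bullet> pd2 cylinder p = 1"
    "pd1 cylinder p \<bullet> pd2 cylinder p = 0"  "pd2 cylinder p \<bullet> pd1 cylinder p = 0"
    "pd1 cylinder p \<bullet> direction p = f' (fst p)" "direction p \<bullet> pd1 cylinder p = f' (fst p)"
    using tt by (simp_all add: p direction_def pd_cylinder cylinder_normal_def inner_vec_def sum_3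
        power2_eq_square)
  show "pd2 cylinder p \<bullet> direction p = g' (snd p)" "direction p \<bullet> pd2 cylinder p = g' (snd p)"
    by (simp_all add: p direction_def pd_cylinder cylinder_normal_def inner_vec_def sum_3)
      (use tt in algebra)+
  have "direction p \<bullet> direction p = (f' s)\<^sup>2 + (g' t)\<^sup>2 + (g t)\<^sup>2"
    by (simp add: p direction_def pd_cylinder cylinder_normal_def inner_vec_def sum_3)
      (use tt in algebra)
  then show "direction p \<bullet> direction p = (f (fst p) + g (snd p)) * assoc_M b c f g p"
    using first_integral [of s t] by (simp add: p assoc_M_def)
qed

lemma assoc_surface_eq:
  "assoc_surface b c f g p = cylinder p - (2 / assoc_M b c f g p) *\<^sub>R direction p"
proof -
  have "deriv f = f'" "deriv g = g'"
    by (auto intro!: DERIV_imp_deriv derivative_intros)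
  then show ?thesis
    by (simp add: assoc_surface_def direction_def)
qed

abbreviation M :: "real \<times> real \<Rightarrow> real" where "M \<equiv> assoc_M b c f g"
abbreviation X :: surface where "X \<equiv> assoc_surface b c f g"

text \<open>Because of \<open>|Y|\<^sup>2 = (f + g) M\<close>, the next two vectors are \<open>- c (f + g) / M\<close> and \<open>c (f + g) / M\<close>
  times the reflections along \<open>Y = direction p\<close> of the two tangent
  vectors of the cylinder. They are the tangent vectors of the associated surface.\<close>

definition X1 :: surface where
  "X1 p = (- c / M p) *\<^sub>R ((f (fst p) + g (snd p)) *\<^sub>R pd1 cylinder p
     - (2 * f' (fst p) / M p) *\<^sub>R direction p)"

definition X2 :: surface where
  "X2 p = (c / M p) *\<^sub>R ((f (fst p) + g (snd p)) *\<^sub>R pd2 cylinder p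
     - (2 * g' (snd p) / M p) *\<^sub>R direction p)"

lemma M_has_derivative:
  "((\<lambda>s. M (s, t)) has_real_derivative c * f' s) (at s)"
  "((\<lambda>t. M (s, t)) has_real_derivative - c * g' t) (at t)"
  unfolding assoc_M_def by (auto intro!: derivative_eq_intros)

lemma pd1_assoc_surface:
  assumes "M (s, t) \<noteq> 0"
  shows "pd1 X (s, t) = X1 (s, t)"
proof (rule pd1_eqI)
  have D: "((\<lambda>s. 2 / M (s, t)) has_real_derivative - (2 * c * f' s) / (M (s, t))\<^sup>2) (at s)"
    by (auto intro!: derivative_eq_intros M_has_derivative assms simp: power2_eq_square)
  \<comment> \<open>Once \<open>b\<close> is eliminated in favour of \<open>M\<close>, the vector identity below is one of rational
    functions in independent quantities.\<close>
  obtain m where m: "M (s, t) = m" by simp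
  have b: "b = (m - c * (f s - g t)) / 2"
    by (simp add: assoc_M_def flip: m)
  have "((\<lambda>s. X (s, t)) has_vector_derivative pd1 cylinder (s, t)
      - ((2 / M (s, t)) *\<^sub>R ((c * f s + b) *\<^sub>R pd1 cylinder (s, t))
        + (- (2 * c * f' s) / (M (s, t))\<^sup>2) *\<^sub>R direction (s, t))) (at s)"
    unfolding assoc_surface_eq pd_cylinder(1)
    by (intro has_vector_derivative_diff has_vector_derivative_scaleR D
        has_vector_derivative_cylinder direction_has_derivative [unfolded pd_cylinder])
  moreover have "pd1 cylinder (s, t)
      - ((2 / M (s, t)) *\<^sub>R ((c * f s + b) *\<^sub>R pd1 cylinder (s, t))
        + (- (2 * c * f' s) / (M (s, t))\<^sup>2) *\<^sub>R direction (s, t)) = X1 (s, t)"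
    using assms unfolding X1_def fst_conv snd_conv m unfolding b
    by (simp add: vec_eq_iff field_simps power2_eq_square)
  ultimately show "((\<lambda>s. X (s, t)) has_vector_derivative X1 (s, t)) (at s)"
    by simp
qed

lemma pd2_assoc_surface:
  assumes "M (s, t) \<noteq> 0"
  shows "pd2 X (s, t) = X2 (s, t)"
proof (rule pd2_eqI)
  have D: "((\<lambda>t. 2 / M (s, t)) has_real_derivative (2 * c * g' t) / (M (s, t))\<^sup>2) (at t)"
    by (auto intro!: derivative_eq_intros M_has_derivative assms simp: power2_eq_square)
  obtain m where m: "M (s, t) = m" by simp
  have b: "b = (m - c * (f s - g t)) / 2"
    by (simp add: assoc_M_def flip: m)
  have "((\<lambda>t. X (s, t)) has_vector_derivative pd2 cylinder (s, t)
      - ((2 / M (s, t)) *\<^sub>R ((b - c * g t) *\<^sub>R pd2 cylinder (s, t))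
        + ((2 * c * g' t) / (M (s, t))\<^sup>2) *\<^sub>R direction (s, t))) (at t)"
    unfolding assoc_surface_eq pd_cylinder(2)
    by (intro has_vector_derivative_diff has_vector_derivative_scaleR D
        has_vector_derivative_cylinder direction_has_derivative [unfolded pd_cylinder])
  moreover have "pd2 cylinder (s, t)
      - ((2 / M (s, t)) *\<^sub>R ((b - c * g t) *\<^sub>R pd2 cylinder (s, t))
        + ((2 * c * g' t) / (M (s, t))\<^sup>2) *\<^sub>R direction (s, t)) = X2 (s, t)"
    using assms unfolding X2_def fst_conv snd_conv m unfolding b
    by (simp add: vec_eq_iff field_simps power2_eq_square)
  ultimately show "((\<lambda>t. X (s, t)) has_vector_derivative X2 (s, t)) (at t)"
    by simp
qed

text \<open>The Gauss equation for isothermal coordinates without a mixed curvature term: the coefficients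
  are the logarithmic derivatives of the conformal factor \<open>\<lambda> = c (f + g) / M\<close>, namely \<open>\<lambda>\<^sub>2 / \<lambda>\<close>
  in front of the first tangent vector and \<open>\<lambda>\<^sub>1 / \<lambda>\<close> in front of the second.\<close>

lemma pd2_X1:
  assumes "M (s, t) \<noteq> 0" "f s + g t \<noteq> 0"
  shows "pd2 X1 (s, t) = (g' t / (f s + g t) + c * g' t / M (s, t)) *\<^sub>R X1 (s, t)
    + (f' s / (f s + g t) - c * f' s / M (s, t)) *\<^sub>R X2 (s, t)"
proof (rule pd2_eqI)
  let ?D = "(- c / M (s, t)) *\<^sub>R (g' t *\<^sub>R pd1 cylinder (s, t)
      - ((2 * f' s / M (s, t)) *\<^sub>R ((b - c * g t) *\<^sub>R pd2 cylinder (s, t))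
        + (2 * c * f' s * g' t / (M (s, t))\<^sup>2) *\<^sub>R direction (s, t)))
      + (- c\<^sup>2 * g' t / (M (s, t))\<^sup>2) *\<^sub>R ((f s + g t) *\<^sub>R pd1 cylinder (s, t)
        - (2 * f' s / M (s, t)) *\<^sub>R direction (s, t))"
  have D: "((\<lambda>t. - c / M (s, t)) has_real_derivative - c\<^sup>2 * g' t / (M (s, t))\<^sup>2) (at t)"
    "((\<lambda>t. 2 * f' s / M (s, t)) has_real_derivative 2 * c * f' s * g' t / (M (s, t))\<^sup>2) (at t)"
    by (auto intro!: derivative_eq_intros M_has_derivative assms simp: power2_eq_square)
  have S: "((\<lambda>t. (f s + g t) *\<^sub>R pd1 cylinder (s, t)) has_vector_derivative
      g' t *\<^sub>R pd1 cylinder (s, t)) (at t)"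
    unfolding pd_cylinder
    by (rule bounded_linear.has_vector_derivative [OF bounded_linear_scaleR_left])
      (auto intro!: derivative_eq_intros
        simp flip: has_real_derivative_iff_has_vector_derivative)
  have D1: "((\<lambda>t. X1 (s, t)) has_vector_derivative ?D) (at t)"
    unfolding X1_def fst_conv snd_conv
    by (intro has_vector_derivative_diff has_vector_derivative_scaleR D S direction_has_derivative)
  obtain m where m: "M (s, t) = m" by simp
  have b: "b = (m - c * (f s - g t)) / 2"
    by (simp add: assoc_M_def flip: m)
  have "?D = (g' t / (f s + g t) + c * g' t / M (s, t)) *\<^sub>R X1 (s, t)
    + (f' s / (f s + g t) - c * f' s / M (s, t)) *\<^sub>R X2 (s, t)"
    using assms unfolding X1_def X2_def fst_conv snd_conv m unfolding b
    by (simp add: vec_eq_iff divide_simps power2_eq_square) (simp add: algebra_simps)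
  with D1 show "((\<lambda>t. X1 (s, t)) has_vector_derivative
      (g' t / (f s + g t) + c * g' t / M (s, t)) *\<^sub>R X1 (s, t)
    + (f' s / (f s + g t) - c * f' s / M (s, t)) *\<^sub>R X2 (s, t)) (at t)"
    by simp
qed

lemma first_fundamental_form:
  assumes "p \<in> assoc_domain b c f g"
  shows "ffE X p = (c * (f (fst p) + g (snd p)) / M p)\<^sup>2"
    and "ffF X p = 0"
    and "ffG X p = (c * (f (fst p) + g (snd p)) / M p)\<^sup>2"
proof -
  have M: "M p \<noteq> 0" using assms by (simp add: assoc_domain_def)
  then have pd: "pd1 X p = X1 p" "pd2 X p = X2 p"
    using pd1_assoc_surface pd2_assoc_surface by (cases p; simp)+
  define S where "S = f (fst p) + g (snd p)"
  let ?v = "S *\<^sub>R pd1 cylinder p - (2 * f' (fst p) / M p) *\<^sub>R direction p"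
  let ?w = "S *\<^sub>R pd2 cylinder p - (2 * g' (snd p) / M p) *\<^sub>R direction p"
  have "?v \<bullet> ?v = S\<^sup>2" "?v \<bullet> ?w = 0" "?w \<bullet> ?w = S\<^sup>2"
    using M by (simp_all add: inner_diff_left inner_diff_right inner_direction power2_eq_square
        flip: S_def) (simp_all add: algebra_simps)
  moreover have "X1 p = (- c / M p) *\<^sub>R ?v" "X2 p = (c / M p) *\<^sub>R ?w"
    by (simp_all only: X1_def X2_def S_def)
  ultimately show "ffE X p = (c * (f (fst p) + g (snd p)) / M p)\<^sup>2" "ffF X p = 0"
    "ffG X p = (c * (f (fst p) + g (snd p)) / M p)\<^sup>2"
    unfolding ffE_def ffF_def ffG_def pd S_def [symmetric]
    by (simp_all add: power2_eq_square)
qed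

text \<open>The mixed derivative is tangent, hence orthogonal to the cross product of the two tangent
  vectors, whatever the length of that product.\<close>

lemma sffF_assoc_surface:
  assumes "p \<in> assoc_domain b c f g"
  shows "sffF X p = 0"
proof -
  obtain s t where p: "p = (s, t)" by force
  have M: "M (s, t) \<noteq> 0" and S: "f s + g t \<noteq> 0"
    using assms by (simp_all add: assoc_domain_def p)
  have "pd2 (pd1 X) (s, t) = pd2 X1 (s, t)"
    using assms by (intro pd2_cong_on [OF open_assoc_domain])
      (auto simp: p assoc_domain_def intro: pd1_assoc_surface)
  then show ?thesis
    unfolding p sffF_def unit_normal_def pd1_assoc_surface [OF M] pd2_assoc_surface [OF M]
    by (simp add: pd2_X1 [OF M S] inner_add_left dot_cross_self)
qed

lemma Ck_on_assoc_surface: "Ck_on k (assoc_domain b c f g) X"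
proof -
  \<comment> \<open>The factor \<open>- 1\<close> makes the first entry a sum of products, matching the closure rules.\<close>
  have dir: "direction p = vector [(- 1) * g' (snd p) * sin (snd p) + g (snd p) * cos (snd p),
      g' (snd p) * cos (snd p) + g (snd p) * sin (snd p), f' (fst p)]" for p
    by (cases p) (simp add: direction_def pd_cylinder cylinder_normal_def vec_eq_iff forall_3)
  show ?thesis
    unfolding assoc_surface_eq dir cylinder_def assoc_M_def
    by (intro Ck_on_diff Ck_on_scaleR Ck_on_vector3 Ck_on_add Ck_on_mult Ck_on_divide Ck_on_const
        Ck_on_profile [OF _ f] Ck_on_profile [OF _ g] Ck_on_profile [OF _ profile_sin_cos]
        Ck_on_profile [OF _ profile_id] open_assoc_domain)
      (auto simp: assoc_domain_def assoc_M_def)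
qed

lemma isothermic_assoc_surface:
  assumes "c \<noteq> 0"
  shows "isothermic_on (assoc_domain b c f g) X"
  using assms unfolding isothermic_on_def
  by (auto simp: open_assoc_domain Ck_on_assoc_surface first_fundamental_form sffF_assoc_surface)
    (auto simp: assoc_domain_def)

end

theorem corollary3p3:
  fixes b c :: real and f g :: "real \<Rightarrow> real"
  assumes "b \<noteq> 0" and "c \<noteq> 0" and "associated_data b c f g"
  shows "isothermic_on (assoc_domain b c f g) (assoc_surface b c f g)
    \<and> (\<forall>p \<in> assoc_domain b c f g.
         ffE (assoc_surface b c f g) p = (c * (f (fst p) + g (snd p)) / assoc_M b c f g p)\<^sup>2 \<and>
         ffF (assoc_surface b c f g) p = 0 \<and>
         ffG (assoc_surface b c f g) p = (c * (f (fst p) + g (snd p)) / assoc_M b c f g p)\<^sup>2)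
    \<and> calapso_solution_on {p \<in> assoc_domain b c f g. assoc_omega b c f g p \<noteq> 0} (assoc_omega b c f g)
    \<and> calapso_solution_on {p \<in> assoc_domain b c f g. assoc_Omega c f g p \<noteq> 0} (assoc_Omega c f g)"
proof -
  obtain K f' g' where "profile_pair b c K f f' g g'"
    using associated_data_profile_pair [OF assms(3)] .
  then interpret profile_pair b c K f f' g g' .
  show ?thesis
    using isothermic_assoc_surface [OF assms(2)] first_fundamental_form
      calapso_omega [OF assms(2)] calapso_Omega by blast
qed

end
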